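(* Let $r\ge 2$ and $d\ge 2$ be fixed integers. The variance $NS_2(r,d)$ satisfies $$NS_2(r,d)=\frac{1}{(d!)^2}\,q^{2r-3}+\mu_d(1-\mu_d)\,q^{r-1}+\mathcal{O}(q^{2r-4}).$$
   Context: $\mathbb{F}_q$ is the finite field with $q$ elements, and $\mathcal{F}_{r,d}$ is the set of all polynomials $F\in\mathbb{F}_q[X_1,\dots,X_r]$ of total degree at most $d$. Put $\mu_d:=\sum_{j=1}^d\frac{(-1)^{j-1}}{j!}$. For $F\in\mathcal{F}_{r,d}$, let $NS(F):=|\{a\in\mathbb{F}_q^{r-1}:\exists\,x\in\mathbb{F}_q,\ F(a,x)=0\}|$, and let $$NS(r,d):=\frac{1}{|\mathcal{F}_{r,d}|}\sum_{F\in\mathcal{F}_{r,d}}NS(F),\qquad NS_2(r,d):=\frac{1}{|\mathcal{F}_{r,d}|}\sum_{F\in\mathcal{F}_{r,d}}\big(NS(F)-NS(r,d)\big)^2 .$$ The asymptotic estimate is for fixed $d$ and $r$ and $q\to\infty$; the implied constant may depend on $d$ and $r$ but not on $q$. *)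

theory Defs
  imports "HOL-Algebra.Indexed_Polynomials" "HOL-Library.Landau_Symbols"
begin

text \<open>
  A polynomial in \<open>X\<^sub>1, \<dots>, X\<^sub>r\<close> is an element of the indexed polynomials over the index set
  \<open>{1..r}\<close>: a function from monomials (multisets of indices) to coefficients. The total degree
  of a monomial is the size of the multiset. The zero polynomial is included.
\<close>

definition polys_deg_le :: "('a, 'b) ring_scheme \<Rightarrow> nat \<Rightarrow> nat \<Rightarrow> (nat multiset \<Rightarrow> 'a) set" where
  "polys_deg_le R r d =
     {F \<in> ring.indexed_pset R {1..r} (carrier R). \<forall>m. F m \<noteq> \<zero>\<^bsub>R\<^esub> \<longrightarrow> size m \<le> d}"

text \<open>The library function \<open>indexed_eval\<close> is not evaluation at a point, so that is defined here.\<close>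

definition eval_at :: "('a, 'b) ring_scheme \<Rightarrow> (nat \<Rightarrow> 'a) \<Rightarrow> (nat multiset \<Rightarrow> 'a) \<Rightarrow> 'a" where
  "eval_at R a F =
     (\<Oplus>\<^bsub>R\<^esub>m\<in>{m. F m \<noteq> \<zero>\<^bsub>R\<^esub>}. F m \<otimes>\<^bsub>R\<^esub> (\<Otimes>\<^bsub>R\<^esub>i\<in>set_mset m. a i [^]\<^bsub>R\<^esub> count m i))"

definition NS :: "('a, 'b) ring_scheme \<Rightarrow> nat \<Rightarrow> (nat multiset \<Rightarrow> 'a) \<Rightarrow> nat" where
  "NS R r F =
     card {a \<in> {1..r - 1} \<rightarrow>\<^sub>E carrier R. \<exists>x\<in>carrier R. eval_at R (a(r := x)) F = \<zero>\<^bsub>R\<^esub>}"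

definition NS_mean :: "('a, 'b) ring_scheme \<Rightarrow> nat \<Rightarrow> nat \<Rightarrow> real" where
  "NS_mean R r d =
     1 / real (card (polys_deg_le R r d)) * (\<Sum>F\<in>polys_deg_le R r d. real (NS R r F))"

definition NS_variance :: "('a, 'b) ring_scheme \<Rightarrow> nat \<Rightarrow> nat \<Rightarrow> real" where
  "NS_variance R r d =
     1 / real (card (polys_deg_le R r d)) *
       (\<Sum>F\<in>polys_deg_le R r d. (real (NS R r F) - NS_mean R r d)\<^sup>2)"

definition mu :: "nat \<Rightarrow> real" where
  "mu d = (\<Sum>j = 1..d. (- 1) ^ (j - 1) / fact j)"

text \<open>
  The filter of finite fields \<open>R\<close> with \<open>order R \<rightarrow> \<infinity>\<close>. It ranges over all finite fields whose
  elements lie in the type \<open>'a\<close>; for an infinite \<open>'a\<close> these are all finite fields up to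
  isomorphism (for a finite \<open>'a\<close> the filter is trivial), so that bounds along it are uniform
  in the field.
\<close>

definition finite_fields_at_top :: "'a ring filter" where
  "finite_fields_at_top =
     inf (filtercomap order at_top) (principal {R. field R \<and> finite (carrier R)})"

lemma eventually_finite_fields_at_top:
  "eventually P finite_fields_at_top \<longleftrightarrow>
     (\<exists>N. \<forall>R. field R \<and> finite (carrier R) \<and> N \<le> order R \<longrightarrow> P R)"
  unfolding finite_fields_at_top_def eventually_inf_principal
    eventually_filtercomap_at_top_linorder
  by auto

end

theory Submission
  imports Defs
begin

text \<open>
  Write \<open>NS(F)\<close> as a sum of indicators over the base points \<open>a\<close>, so that the variance is a sum
  of covariances. For \<open>a \<noteq> b\<close> the pair of slices \<open>(F(a, X\<^sub>r), F(b, X\<^sub>r))\<close> is uniformly distributed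
  over the pairs of univariate polynomials of degree at most \<open>d\<close> with the same coefficient of
  \<open>X\<^sub>r\<^sup>d\<close>: that coefficient does not depend on the base point, and every other coefficient involves
  a free affine function of the base coordinates. Hence the off-diagonal covariance is the variance,
  over a uniform leading coefficient \<open>c\<close>, of the probability that a univariate polynomial has a root.
  This probability takes only two values, one for \<open>c \<noteq> 0\<close> and one for \<open>c = 0\<close>. Inclusion-exclusion
  over the roots shows that they differ only by the contribution \<open>\<kappa>\<close> of the zero polynomial,
  with \<open>\<kappa>\<^sup>2 = 1/(d!)\<^sup>2 + O(1/q)\<close>. This gives the exact formula
  \<open>q\<^sup>r\<^sup>-\<^sup>1 p (1 - p) + q\<^sup>r\<^sup>-\<^sup>1 (q\<^sup>r\<^sup>-\<^sup>1 - 1) \<kappa>\<^sup>2 (q - 1) / q\<^sup>2\<close>, in which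
  \<open>p = \<mu>\<^sub>d + O(1/q)\<close> is the probability that a single slice has a root.
\<close>

section \<open>Univariate polynomials without roots\<close>

locale finite_field = field R for R (structure) +
  assumes finite_carrier [simp, intro]: "finite (carrier R)"

definition (in ring) poly_value :: "nat \<Rightarrow> (nat \<Rightarrow> 'a) \<Rightarrow> 'a \<Rightarrow> 'a" where
  "poly_value d u x = (\<Oplus>k\<in>{..d}. u k \<otimes> x [^] k)"

definition (in ring) roots_of :: "nat \<Rightarrow> (nat \<Rightarrow> 'a) \<Rightarrow> 'a set" where
  "roots_of d u = {x \<in> carrier R. poly_value d u x = \<zero>}"

text \<open>Extensional functions let each polynomial of degree at most \<open>d\<close> correspond
  to exactly one vector, so cardinalities count polynomials; \<open>c\<close> may be zero, so the
  degree can drop.\<close>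

definition (in ring) coeff_vectors :: "nat \<Rightarrow> 'a \<Rightarrow> (nat \<Rightarrow> 'a) set" where
  "coeff_vectors d c = (\<Pi>\<^sub>E k\<in>{..d}. if k = d then {c} else carrier R)"

lemma (in ring) coeff_vectors_closed:
  assumes "u \<in> coeff_vectors d c" "c \<in> carrier R"
  shows "u \<in> {..d} \<rightarrow> carrier R" "u d = c"
  using assms by (auto simp: coeff_vectors_def PiE_iff split: if_splits)

lemma (in ring) poly_value_closed [intro, simp]:
  "u \<in> {..d} \<rightarrow> carrier R \<Longrightarrow> x \<in> carrier R \<Longrightarrow> poly_value d u x \<in> carrier R"
  unfolding poly_value_def by (intro finsum_closed) auto

lemma (in ring) poly_value_diff:
  assumes u: "u \<in> {..d} \<rightarrow> carrier R" and v: "v \<in> {..d} \<rightarrow> carrier R" and x: "x \<in> carrier R"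
  shows "poly_value d (\<lambda>k. u k \<ominus> v k) x = poly_value d u x \<ominus> poly_value d v x"
proof -
  have "poly_value d (\<lambda>k. u k \<ominus> v k) x \<oplus> poly_value d v x = poly_value d u x"
  proof -
    have "poly_value d (\<lambda>k. u k \<ominus> v k) x \<oplus> poly_value d v x =
        (\<Oplus>k\<in>{..d}. (u k \<ominus> v k) \<otimes> x [^] k \<oplus> v k \<otimes> x [^] k)"
      unfolding poly_value_def using u v x by (intro finsum_addf [symmetric]) auto
    also have "\<dots> = poly_value d u x"
      unfolding poly_value_def
    proof (intro finsum_cong' refl)
      fix k assume "k \<in> {..d}"
      then have c: "u k \<in> carrier R" "v k \<in> carrier R" "x [^] k \<in> carrier R"
        using u v x by auto
      then show "(u k \<ominus> v k) \<otimes> x [^] k \<oplus> v k \<otimes> x [^] k = u k \<otimes> x [^] k"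
        by algebra
    qed (use u x in auto)
    finally show ?thesis .
  qed
  moreover have "poly_value d (\<lambda>k. u k \<ominus> v k) x \<in> carrier R"
    by (rule poly_value_closed[OF _ x]) (use u v in \<open>simp add: Pi_iff\<close>)
  moreover have "poly_value d v x \<in> carrier R"
    by (rule poly_value_closed[OF v x])
  moreover have "a = (a \<oplus> b) \<ominus> b" if "a \<in> carrier R" "b \<in> carrier R" for a b
    using that by algebra
  ultimately show ?thesis
    by metis
qed

text \<open>The root bound in \<open>UP R\<close>. The degree bound \<open>j\<close> is kept apart
  from the index bound \<open>d\<close>: it is applied with \<open>j = d\<close> to nonzero vectors
  and with a smaller \<open>j\<close> to differences whose upper entries cancel.\<close>

lemma (in finite_field) card_roots_of_le:
  assumes u: "u \<in> {..d} \<rightarrow> carrier R" and "j \<le> d" and above: "\<And>k. j < k \<Longrightarrow> k \<le> d \<Longrightarrow> u k = \<zero>"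
    and nz: "\<exists>k\<le>d. u k \<noteq> \<zero>"
  shows "card (roots_of d u) \<le> j"
proof -
  \<comment> \<open>Entries of \<open>u\<close> beyond \<open>d\<close> are arbitrary, so they are
    replaced by zero to obtain an element of \<open>up R\<close>.\<close>
  define f where "f = (\<lambda>k. if k \<le> d then u k else \<zero>)"
  have "bound \<zero> d f"
    by (auto simp: bound_def f_def)
  moreover have "f k \<in> carrier R" for k
    using u by (auto simp: f_def)
  ultimately have "f \<in> up R"
    by (intro mem_upI exI)
  then have f: "f \<in> carrier (UP R)"
    unfolding UP_def partial_object.select_convs .
  interpret U: UP_domain R "UP R" by unfold_locales
  have coeff: "UnivPoly.coeff (UP R) f k = f k" for k
    using \<open>f \<in> up R\<close> unfolding UP_def up_ring.select_convs by simp
  have deg: "deg R f \<le> j"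
    by (rule U.deg_aboveI[OF _ f]) (simp add: coeff, simp add: f_def above)
  have "f \<noteq> \<zero>\<^bsub>UP R\<^esub>"
  proof
    assume "f = \<zero>\<^bsub>UP R\<^esub>"
    then have "f k = \<zero>" for k
      using U.coeff_zero[of k] coeff[of k] by simp
    with nz show False by (metis f_def)
  qed
  from U.roots_bound[OF f this finite_carrier]
  have "card {x \<in> carrier R. UnivPoly.eval R R id x f = \<zero>} \<le> j"
    using deg by simp
  moreover have "UnivPoly.eval R R id x f = poly_value d u x" if x: "x \<in> carrier R" for x
  proof -
    have fc: "f k \<in> carrier R" for k
      using u by (auto simp: f_def)
    have "UnivPoly.eval R R id x f = (\<Oplus>k\<in>{..deg R f}. f k \<otimes> x [^] k)"
      using U.eval_on_carrier[OF f, of R id x] by (simp add: coeff)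
    also have "\<dots> = (\<Oplus>k\<in>{..d}. f k \<otimes> x [^] k)"
    proof (rule add.finprod_mono_neutral_cong_left)
      show "{..deg R f} \<subseteq> {..d}"
        using deg \<open>j \<le> d\<close> by auto
      show "f k \<otimes> x [^] k = \<zero>" if "k \<in> {..d} - {..deg R f}" for k
      proof -
        have "f k = \<zero>"
          using U.deg_aboveD[OF _ f, of k] that by (simp add: coeff)
        then show ?thesis using x by simp
      qed
    qed (use fc x in auto)
    also have "\<dots> = poly_value d u x"
      unfolding poly_value_def by (rule finsum_cong') (use u x in \<open>auto simp: f_def\<close>)
    finally show ?thesis .
  qed
  ultimately show ?thesis
    unfolding roots_of_def by (simp cong: conj_cong)
qed

section \<open>Counting coefficient vectors with prescribed roots\<close>

lemma (in finite_field) finite_roots_of [simp, intro]: "finite (roots_of d u)"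
  by (simp add: roots_of_def)

lemma (in finite_field) finite_coeff_vectors [simp, intro]: "finite (coeff_vectors d c)"
  unfolding coeff_vectors_def by (intro finite_PiE) auto

lemma (in finite_field) card_coeff_block:
  assumes "j \<le> d"
  shows "card (\<Pi>\<^sub>E k\<in>{j..d}. if k = d then {c} else carrier R) = order R ^ (d - j)"
proof -
  have split: "{j..d} = insert d {j..<d}"
    using assms by auto
  have "card (\<Pi>\<^sub>E k\<in>{j..d}. if k = d then {c} else carrier R) =
      (\<Prod>k\<in>insert d {j..<d}. card (if k = d then {c} else carrier R))"
    unfolding split by (intro card_PiE) auto
  also have "\<dots> = (\<Prod>k\<in>{j..<d}. order R)"
    by (simp add: order_def)
  finally show ?thesis by simp
qed

lemma (in finite_field) card_coeff_vectors: "card (coeff_vectors d c) = order R ^ d"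
  using card_coeff_block[of 0 d c] by (simp add: coeff_vectors_def atLeast0AtMost)

text \<open>A vector is determined by its entries of index \<open>\<ge> card S\<close> and the values on \<open>S\<close>;
  counting shows that both can be prescribed freely.\<close>

lemma (in finite_field) card_coeff_vectors_vanishing:
  assumes S: "S \<subseteq> carrier R" and le: "card S \<le> d" and c: "c \<in> carrier R"
  shows "card {u \<in> coeff_vectors d c. S \<subseteq> roots_of d u} = order R ^ (d - card S)"
proof -
  define j where "j = card S"
  define G where "G = (\<Pi>\<^sub>E k\<in>{j..d}. if k = d then {c} else carrier R)"
  define \<Psi> where "\<Psi> u = (restrict u {j..d}, \<lambda>x\<in>S. poly_value d u x)" for u
  have [simp]: "finite S" using S finite_subset by blast
  have jd: "j \<le> d" using le by (simp add: j_def)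
  have inj: "inj_on \<Psi> (coeff_vectors d c)"
  proof (rule inj_onI)
    fix u v assume u: "u \<in> coeff_vectors d c" and v: "v \<in> coeff_vectors d c" and eq: "\<Psi> u = \<Psi> v"
    note uc = coeff_vectors_closed(1)[OF u c] and vc = coeff_vectors_closed(1)[OF v c]
    have top: "u k = v k" if "j \<le> k" "k \<le> d" for k
      using eq that unfolding \<Psi>_def prod.inject by (metis atLeastAtMost_iff restrict_apply')
    have S0: "S \<subseteq> roots_of d (\<lambda>k. u k \<ominus> v k)"
    proof
      fix x assume x: "x \<in> S"
      then have "poly_value d u x = poly_value d v x"
        using eq unfolding \<Psi>_def prod.inject by (metis restrict_apply')
      then show "x \<in> roots_of d (\<lambda>k. u k \<ominus> v k)"
        using x S poly_value_diff[OF uc vc, of x] poly_value_closed[OF vc, of x]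
        by (auto simp: roots_of_def)
    qed
    have "u k \<ominus> v k = \<zero>" if kd: "k \<le> d" for k
    proof (rule ccontr)
      assume nz: "u k \<ominus> v k \<noteq> \<zero>"
      then have "k < j" using top[of k] kd vc by (metis PiE atMost_iff not_less r_right_minus_eq)
      \<comment> \<open>Vanishing from index \<open>j\<close> on forces at most \<open>j - 1\<close>
        roots, against the \<open>j\<close> points of \<open>S\<close>; \<open>k < j\<close> makes
        this natural subtraction genuine.\<close>
      have "card (roots_of d (\<lambda>k. u k \<ominus> v k)) \<le> j - 1"
      proof (rule card_roots_of_le)
        show "u i \<ominus> v i = \<zero>" if "j - 1 < i" "i \<le> d" for i
          using top[of i] that vc by (auto simp: Pi_iff)
      qed (use uc vc jd nz kd in \<open>auto simp: Pi_iff\<close>)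
      with card_mono[OF _ S0] \<open>k < j\<close> show False
        by (simp add: j_def)
    qed
    then have "u k = v k" if "k \<le> d" for k
      using that uc vc by (auto simp: Pi_iff)
    then show "u = v"
      using u v unfolding coeff_vectors_def by (intro PiE_ext) auto
  qed
  have img: "\<Psi> ` coeff_vectors d c \<subseteq> G \<times> (S \<rightarrow>\<^sub>E carrier R)"
  proof (rule image_subsetI)
    fix u assume u: "u \<in> coeff_vectors d c"
    show "\<Psi> u \<in> G \<times> (S \<rightarrow>\<^sub>E carrier R)"
      using u coeff_vectors_closed(1)[OF u c] S
      by (auto simp: \<Psi>_def G_def coeff_vectors_def PiE_iff)
  qed
  have cardG: "card G = order R ^ (d - j)"
    unfolding G_def by (rule card_coeff_block[OF jd])
  have finG: "finite G" unfolding G_def by (intro finite_PiE) auto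
  \<comment> \<open>Source and target have the same size \<open>order R ^ d\<close>, so the
    injection is onto.\<close>
  have "card (G \<times> (S \<rightarrow>\<^sub>E carrier R)) = order R ^ d"
    using jd by (simp add: card_cartesian_product cardG card_PiE order_def j_def flip: power_add)
  then have surj: "\<Psi> ` coeff_vectors d c = G \<times> (S \<rightarrow>\<^sub>E carrier R)"
    using finG inj
    by (intro card_subset_eq img) (auto simp: card_image card_coeff_vectors intro!: finite_PiE)
  \<comment> \<open>Prescribing the value zero on all of \<open>S\<close> leaves exactly the upper
    block \<open>G\<close> free.\<close>
  have "bij_betw \<Psi> {u \<in> coeff_vectors d c. S \<subseteq> roots_of d u} (G \<times> {\<lambda>x\<in>S. \<zero>})"
  proof (rule bij_betw_imageI)
    show "inj_on \<Psi> {u \<in> coeff_vectors d c. S \<subseteq> roots_of d u}"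
      by (rule inj_on_subset[OF inj]) auto
    have eq: "snd (\<Psi> u) = (\<lambda>x\<in>S. \<zero>) \<longleftrightarrow> S \<subseteq> roots_of d u" for u
    proof -
      have "snd (\<Psi> u) = (\<lambda>x\<in>S. \<zero>) \<longleftrightarrow> (\<forall>x\<in>S. poly_value d u x = \<zero>)"
        by (auto simp: \<Psi>_def restrict_def fun_eq_iff)
      then show ?thesis using S by (auto simp: roots_of_def)
    qed
    have "\<Psi> ` {u \<in> coeff_vectors d c. S \<subseteq> roots_of d u}
        = {y \<in> \<Psi> ` coeff_vectors d c. snd y = (\<lambda>x\<in>S. \<zero>)}"
      by (auto simp: eq)
    also have "\<dots> = G \<times> {\<lambda>x\<in>S. \<zero>}"
      unfolding surj by auto
    finally show "\<Psi> ` {u \<in> coeff_vectors d c. S \<subseteq> roots_of d u} = G \<times> {\<lambda>x\<in>S. \<zero>}" .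
  qed
  from bij_betw_same_card[OF this] show ?thesis
    by (simp add: card_cartesian_product cardG j_def)
qed

text \<open>The terms beyond \<open>n\<close> vanish, so truncation leaves the full expansion of
  \<open>(1 - 1)^n\<close>. With \<open>n\<close> the number of roots this is the indicator of
  having no root.\<close>

lemma alternating_binomial_sum:
  assumes "n \<le> d"
  shows "(\<Sum>j\<le>d. (- 1) ^ j * real (n choose j)) = (if n = 0 then 1 else 0)"
proof -
  have "(\<Sum>j\<le>d. (- 1) ^ j * real (n choose j)) = (\<Sum>j\<le>n. (- 1) ^ j * real (n choose j))"
    by (rule sum.mono_neutral_right) (use assms in auto)
  then show ?thesis
    using choose_alternating_sum[of n, where ?'a = real] by auto
qed

text \<open>Inclusion-exclusion over the roots. Truncation at \<open>d\<close> is exact except for the zero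
  polynomial.\<close>

lemma (in finite_field) card_rootless:
  assumes c: "c \<in> carrier R"
  shows "real (card {u \<in> coeff_vectors d c. roots_of d u = {}}) =
     (\<Sum>j\<le>d. (- 1) ^ j * real (order R choose j) * real (order R) ^ (d - j))
     - (if c = \<zero> then (\<Sum>j\<le>d. (- 1) ^ j * real (order R choose j)) else 0)"
proof -
  let ?W = "coeff_vectors d c"
  \<comment> \<open>The zero vector is the one vector to which the root bound does not apply; it
    occurs only for \<open>c = \<zero>\<close>.\<close>
  define z where "z = (\<lambda>k\<in>{..d}. \<zero>)"
  define E where "E = (\<Sum>j\<le>d. (- 1) ^ j * real (order R choose j))"
  have z_in: "z \<in> ?W \<longleftrightarrow> c = \<zero>"
    using c by (auto simp: z_def coeff_vectors_def PiE_iff)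
  \<comment> \<open>For \<open>z\<close> every field element is a root, so the truncated sum equals
    \<open>E\<close> and subtracting \<open>E\<close> restores the indicator value 0.\<close>
  have indic: "(if roots_of d u = {} then 1 else 0) =
      (\<Sum>j\<le>d. (- 1) ^ j * real (card (roots_of d u) choose j)) - (if u = z then E else 0)"
    if u: "u \<in> ?W" for u
  proof (cases "u = z")
    case True
    have "poly_value d z x = \<zero>" if "x \<in> carrier R" for x
      unfolding poly_value_def by (rule add.finprod_one_eqI) (use that in \<open>auto simp: z_def\<close>)
    then have "roots_of d z = carrier R"
      by (auto simp: roots_of_def)
    then show ?thesis
      using True zero_closed by (auto simp: E_def order_def simp del: zero_closed)
  next
    case False
    have "\<exists>k\<le>d. u k \<noteq> \<zero>"
    proof (rule ccontr)
      assume "\<not> ?thesis"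
      then have "u = z"
        using u by (auto simp: coeff_vectors_def z_def PiE_iff extensional_def fun_eq_iff)
      with False show False by simp
    qed
    then have "card (roots_of d u) \<le> d"
      using coeff_vectors_closed(1)[OF u c] by (intro card_roots_of_le) auto
    from alternating_binomial_sum[OF this] False show ?thesis
      by auto
  qed
  \<comment> \<open>Double counting of pairs of a vector and a \<open>j\<close>-element set of its
    roots; \<open>j \<le> d\<close> is what allows the values on such a set to be
    prescribed.\<close>
  have moment: "(\<Sum>u\<in>?W. real (card (roots_of d u) choose j)) =
      real (order R choose j) * real (order R) ^ (d - j)" if "j \<le> d" for j
  proof -
    let ?\<S> = "{S. S \<subseteq> carrier R \<and> card S = j}"
    have fin: "finite ?\<S>" by (rule finite_subset[of _ "Pow (carrier R)"]) auto
    have "(\<Sum>u\<in>?W. card (roots_of d u) choose j) =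
        (\<Sum>u\<in>?W. card {S \<in> ?\<S>. S \<subseteq> roots_of d u})"
    proof (intro sum.cong refl)
      fix u
      have "{S \<in> ?\<S>. S \<subseteq> roots_of d u} = {S. S \<subseteq> roots_of d u \<and> card S = j}"
        by (auto simp: roots_of_def)
      then show "card (roots_of d u) choose j = card {S \<in> ?\<S>. S \<subseteq> roots_of d u}"
        by (simp add: n_subsets)
    qed
    also have "\<dots> = (\<Sum>S\<in>?\<S>. card {u \<in> ?W. S \<subseteq> roots_of d u})"
      using sum.swap_restrict[of ?W ?\<S> "\<lambda>_ _. 1::nat" "\<lambda>u S. S \<subseteq> roots_of d u"] fin by simp
    also have "\<dots> = (\<Sum>S\<in>?\<S>. order R ^ (d - j))"
      using that c by (intro sum.cong refl) (auto simp: card_coeff_vectors_vanishing)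
    also have "\<dots> = (order R choose j) * order R ^ (d - j)"
      by (simp add: n_subsets order_def)
    finally show ?thesis
      by (metis of_nat_mult of_nat_power of_nat_sum)
  qed
  have "real (card {u \<in> ?W. roots_of d u = {}}) = (\<Sum>u\<in>?W. if roots_of d u = {} then 1 else 0)"
    by (simp add: sum.If_cases Int_def)
  also have "\<dots> = (\<Sum>u\<in>?W. \<Sum>j\<le>d. (- 1) ^ j * real (card (roots_of d u) choose j))
      - (\<Sum>u\<in>?W. if u = z then E else 0)"
    by (simp add: indic sum_subtractf)
  also have "(\<Sum>u\<in>?W. if u = z then E else 0) = (if c = \<zero> then E else 0)"
    by (simp add: sum.delta z_in)
  also have "(\<Sum>u\<in>?W. \<Sum>j\<le>d. (- 1) ^ j * real (card (roots_of d u) choose j)) =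
      (\<Sum>j\<le>d. (- 1) ^ j * (\<Sum>u\<in>?W. real (card (roots_of d u) choose j)))"
    by (subst sum.swap) (simp add: sum_distrib_left)
  finally show ?thesis
    by (simp add: moment E_def mult.assoc)
qed

section \<open>Slices of multivariate polynomials\<close>

definition monoms :: "nat \<Rightarrow> nat \<Rightarrow> nat multiset set" where
  "monoms r d = {m. set_mset m \<subseteq> {1..r} \<and> size m \<le> d}"

lemma finite_monoms [simp, intro]: "finite (monoms r d)"
proof (rule finite_subset)
  show "monoms r d \<subseteq> (\<Union>n\<le>d. multisets_of_size {1..r} n)"
    by (auto simp: monoms_def multisets_of_size_def)
qed (auto intro!: finite_multisets_of_size)

lemma (in ring) indexed_pset_support:
  assumes "F \<in> indexed_pset I (carrier R)" "F m \<noteq> \<zero>"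
  shows "set_mset m \<subseteq> I"
  using assms
proof (induction arbitrary: m)
  case (indexed_const k)
  then show ?case by (auto simp: indexed_const_def split: if_splits)
next
  case (indexed_padd P Q)
  then show ?case by (metis indexed_padd_def r_zero zero_closed)
next
  case (indexed_pmult P i)
  then have i: "i \<in># m" "P (m - {#i#}) \<noteq> \<zero>"
    by (auto simp: indexed_pmult_def split: if_splits)
  then obtain n where "m = add_mset i n"
    by (auto dest: multi_member_split)
  with i indexed_pmult.IH[of n] indexed_pmult.hyps show ?case by simp
qed

lemma (in ring) monom_in_indexed_pset:
  assumes "set_mset m \<subseteq> I" "k \<in> carrier R"
  shows "(\<lambda>n. if n = m then k else \<zero>) \<in> indexed_pset I (carrier R)"
  using assms(1)
proof (induction m)
  case empty
  then show ?case
    using indexed_pset.indexed_const[OF assms(2), of I] by (simp add: indexed_const_def)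
next
  case (add i m)
  have "(\<lambda>n. if n = add_mset i m then k else \<zero>) = indexed_pmult (\<lambda>n. if n = m then k else \<zero>) i"
    by (auto simp: indexed_pmult_def fun_eq_iff dest: multi_member_split)
  with add show ?case by (simp add: indexed_pset.indexed_pmult)
qed

lemma (in ring) finite_support_in_indexed_pset:
  assumes "finite M" "\<And>m. F m \<in> carrier R" "\<And>m. F m \<noteq> \<zero> \<Longrightarrow> m \<in> M"
    "\<And>m. m \<in> M \<Longrightarrow> set_mset m \<subseteq> I"
  shows "F \<in> indexed_pset I (carrier R)"
  using assms
proof (induction M arbitrary: F)
  case empty
  then have "F = indexed_const \<zero>" by (auto simp: indexed_const_def)
  then show ?case by (simp add: indexed_pset.indexed_const)
next
  case (insert m M)
  have "F(m := \<zero>) \<in> indexed_pset I (carrier R)"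
    using insert.prems by (intro insert.IH) (auto split: if_splits)
  moreover have "(\<lambda>n. if n = m then F m else \<zero>) \<in> indexed_pset I (carrier R)"
    using insert.prems by (intro monom_in_indexed_pset) auto
  moreover have "F = indexed_padd (F(m := \<zero>)) (\<lambda>n. if n = m then F m else \<zero>)"
    using insert.prems(1) by (auto simp: indexed_padd_def fun_eq_iff)
  ultimately show ?case
    using indexed_pset.indexed_padd by metis
qed

text \<open>Trades the inductively generated \<open>indexed_pset\<close> for a pointwise condition,
  so that sums and explicitly built polynomials can be checked coefficient by coefficient.\<close>

lemma (in ring) polys_deg_le_iff:
  "F \<in> polys_deg_le R r d \<longleftrightarrow>
     (\<forall>m. F m \<in> carrier R) \<and> (\<forall>m. F m \<noteq> \<zero> \<longrightarrow> m \<in> monoms r d)"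
proof
  assume "F \<in> polys_deg_le R r d"
  then have F: "F \<in> indexed_pset {1..r} (carrier R)" and deg: "\<And>m. F m \<noteq> \<zero> \<Longrightarrow> size m \<le> d"
    by (auto simp: polys_deg_le_def)
  show "(\<forall>m. F m \<in> carrier R) \<and> (\<forall>m. F m \<noteq> \<zero> \<longrightarrow> m \<in> monoms r d)"
    using indexed_pset_in_carrier[OF subset_refl F] indexed_pset_support[OF F] deg
    by (auto simp: carrier_coeff_def monoms_def)
next
  assume F: "(\<forall>m. F m \<in> carrier R) \<and> (\<forall>m. F m \<noteq> \<zero> \<longrightarrow> m \<in> monoms r d)"
  then have "F \<in> indexed_pset {1..r} (carrier R)"
    by (intro finite_support_in_indexed_pset[OF finite_monoms[of r d]]) (auto simp: monoms_def)
  with F show "F \<in> polys_deg_le R r d"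
    by (auto simp: polys_deg_le_def monoms_def)
qed

lemma (in finite_field) finite_polys_deg_le [simp, intro]: "finite (polys_deg_le R r d)"
proof (rule finite_imageD[of "\<lambda>F. restrict F (monoms r d)"])
  have "(\<lambda>F. restrict F (monoms r d)) ` polys_deg_le R r d \<subseteq> monoms r d \<rightarrow>\<^sub>E carrier R"
    by (auto simp: polys_deg_le_iff)
  then show "finite ((\<lambda>F. restrict F (monoms r d)) ` polys_deg_le R r d)"
    by (rule finite_subset) (intro finite_PiE; simp)
  show "inj_on (\<lambda>F. restrict F (monoms r d)) (polys_deg_le R r d)"
  proof (rule inj_onI, rule ext)
    fix F G m
    assume *: "F \<in> polys_deg_le R r d" "G \<in> polys_deg_le R r d"
      "restrict F (monoms r d) = restrict G (monoms r d)"
    show "F m = G m"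
      using * by (cases "m \<in> monoms r d") (metis restrict_apply', metis polys_deg_le_iff)
  qed
qed

lemma (in ring) card_polys_deg_le_pos:
  assumes "finite (polys_deg_le R r d)"
  shows "card (polys_deg_le R r d) > 0"
proof -
  have "(\<lambda>_. \<zero>) \<in> polys_deg_le R r d"
    by (simp add: polys_deg_le_iff)
  with assms show ?thesis by (auto simp: card_gt_0_iff)
qed

section \<open>Slices of a polynomial over a base point\<close>

definition (in ring) monom_value :: "nat \<Rightarrow> (nat \<Rightarrow> 'a) \<Rightarrow> nat multiset \<Rightarrow> 'a" where
  "monom_value r a m = (\<Otimes>i\<in>set_mset m - {r}. a i [^] count m i)"

text \<open>The coefficients of \<open>F(a, X\<^sub>r)\<close> as a polynomial in \<open>X\<^sub>r\<close>.\<close>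

definition (in ring) slice_coeffs ::
    "nat \<Rightarrow> nat \<Rightarrow> (nat \<Rightarrow> 'a) \<Rightarrow> (nat multiset \<Rightarrow> 'a) \<Rightarrow> nat \<Rightarrow> 'a" where
  "slice_coeffs r d a F =
     (\<lambda>k\<in>{..d}. \<Oplus>m\<in>{m \<in> monoms r d. count m r = k}. F m \<otimes> monom_value r a m)"

lemma (in cring) monom_value_closed:
  assumes "a \<in> {1..r - 1} \<rightarrow> carrier R" "m \<in> monoms r d"
  shows "monom_value r a m \<in> carrier R"
  unfolding monom_value_def
proof (rule finprod_closed, rule funcsetI)
  fix i assume i: "i \<in> set_mset m - {r}"
  then have "i \<in> {1..r}" using assms(2) by (auto simp: monoms_def)
  with i have "i \<in> {1..r - 1}" by auto
  with assms(1) show "a i [^] count m i \<in> carrier R" by auto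
qed

lemma (in cring) slice_coeffs_closed:
  assumes "a \<in> {1..r - 1} \<rightarrow> carrier R" "F \<in> polys_deg_le R r d"
  shows "slice_coeffs r d a F \<in> {..d} \<rightarrow>\<^sub>E carrier R"
  unfolding slice_coeffs_def
proof (rule restrict_PiE_iff[THEN iffD2], rule ballI, rule finsum_closed, rule funcsetI)
  fix k m assume "m \<in> {m \<in> monoms r d. count m r = k}"
  then have "monom_value r a m \<in> carrier R"
    using monom_value_closed[OF assms(1), of m d] by simp
  then show "F m \<otimes> monom_value r a m \<in> carrier R"
    using assms(2) by (simp add: polys_deg_le_iff)
qed

text \<open>Monomials are grouped by their exponent of \<open>X_r\<close>: each value splits into
  \<open>monom_value\<close>, which skips the index \<open>r\<close>, and a power of
  \<open>x\<close>.\<close>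

lemma (in cring) eval_at_slice:
  assumes a: "a \<in> {1..r - 1} \<rightarrow> carrier R" and x: "x \<in> carrier R" and F: "F \<in> polys_deg_le R r d"
  shows "eval_at R (a(r := x)) F = poly_value d (slice_coeffs r d a F) x"
proof -
  define M where "M k = {m \<in> monoms r d. count m r = k}" for k
  have Fc: "F m \<in> carrier R" for m using F by (simp add: polys_deg_le_iff)
  have val: "(\<Otimes>i\<in>set_mset m. (a(r := x)) i [^] count m i) = monom_value r a m \<otimes> x [^] count m r"
    if m: "m \<in> monoms r d" for m
  proof -
    define g where "g = (\<lambda>i. (a(r := x)) i [^] count m i)"
    have gr: "g r = x [^] count m r" by (simp add: g_def)
    have g_off: "g i = a i [^] count m i" "g i \<in> carrier R" if i: "i \<in> set_mset m - {r}" for i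
    proof -
      have "i \<in> {1..r}" using i m by (auto simp: monoms_def)
      with i have "i \<in> {1..r - 1}" "i \<noteq> r" by auto
      with a show "g i = a i [^] count m i" "g i \<in> carrier R" by (auto simp: g_def)
    qed
    have off: "finprod R g (set_mset m - {r}) = monom_value r a m"
      unfolding monom_value_def using g_off by (intro finprod_cong') auto
    have "finprod R g (set_mset m) = monom_value r a m \<otimes> x [^] count m r"
    proof (cases "r \<in># m")
      case True
      then have "finprod R g (set_mset m) = finprod R g (insert r (set_mset m - {r}))"
        by (simp add: insert_absorb)
      also have "\<dots> = x [^] count m r \<otimes> monom_value r a m"
        using g_off x by (subst finprod_insert) (auto simp: off gr)
      finally show ?thesis
        using x monom_value_closed[OF a m] by (simp add: m_comm)
    next
      case False
      then have "set_mset m - {r} = set_mset m" "count m r = 0"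
        by (auto simp: count_eq_zero_iff)
      then show ?thesis using off monom_value_closed[OF a m] by simp
    qed
    then show ?thesis unfolding g_def .
  qed
  have cl: "F m \<otimes> (monom_value r a m \<otimes> x [^] k) \<in> carrier R" if "m \<in> monoms r d" for m and k :: nat
    using Fc x monom_value_closed[OF a that] by simp
  have "eval_at R (a(r := x)) F =
      (\<Oplus>m\<in>monoms r d. F m \<otimes> (monom_value r a m \<otimes> x [^] count m r))"
    unfolding eval_at_def
  proof (rule add.finprod_mono_neutral_cong_left)
    show sub: "{m. F m \<noteq> \<zero>} \<subseteq> monoms r d"
      using F by (auto simp: polys_deg_le_iff)
    show "F m \<otimes> (monom_value r a m \<otimes> x [^] count m r) = \<zero>" if "m \<in> monoms r d - {m. F m \<noteq> \<zero>}" for m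
      using that x monom_value_closed[OF a, of m d] by simp
    show "F m \<otimes> (\<Otimes>i\<in>set_mset m. (a(r := x)) i [^] count m i) =
        F m \<otimes> (monom_value r a m \<otimes> x [^] count m r)" if "m \<in> {m. F m \<noteq> \<zero>}" for m
      using val[of m] sub that by auto
  qed (use cl in auto)
  \<comment> \<open>The exponent of \<open>X_r\<close> is at most the size of the monomial, so the
    disjoint classes \<open>M k\<close> with \<open>k \<le> d\<close> exhaust
    \<open>monoms r d\<close>.\<close>
  also have "monoms r d = \<Union>(M ` {..d})"
    by (auto simp: M_def monoms_def intro: order_trans[OF count_le_size])
  also have "(\<Oplus>m\<in>\<Union>(M ` {..d}). F m \<otimes> (monom_value r a m \<otimes> x [^] count m r)) =
      (\<Oplus>k\<in>{..d}. \<Oplus>m\<in>M k. F m \<otimes> (monom_value r a m \<otimes> x [^] count m r))"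
    by (rule add.finprod_UN_disjoint) (use cl in \<open>auto simp: M_def pairwise_def disjnt_def\<close>)
  also have "\<dots> = poly_value d (slice_coeffs r d a F) x"
    unfolding poly_value_def
  proof (rule finsum_cong')
    fix k assume k: "k \<in> {..d}"
    have "(\<Oplus>m\<in>M k. F m \<otimes> (monom_value r a m \<otimes> x [^] count m r)) =
        (\<Oplus>m\<in>M k. (F m \<otimes> monom_value r a m) \<otimes> x [^] k)"
    proof (rule finsum_cong')
      fix m assume "m \<in> M k"
      then show "F m \<otimes> (monom_value r a m \<otimes> x [^] count m r) = (F m \<otimes> monom_value r a m) \<otimes> x [^] k"
        using Fc x monom_value_closed[OF a, of m d] by (simp add: M_def m_assoc)
    qed (use Fc x monom_value_closed[OF a] in \<open>auto simp: M_def\<close>)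
    also have "\<dots> = (\<Oplus>m\<in>M k. F m \<otimes> monom_value r a m) \<otimes> x [^] k"
      by (rule finsum_ldistr[symmetric]) (use Fc x monom_value_closed[OF a] in \<open>auto simp: M_def\<close>)
    finally show "(\<Oplus>m\<in>M k. F m \<otimes> (monom_value r a m \<otimes> x [^] count m r)) =
        slice_coeffs r d a F k \<otimes> x [^] k"
      using k by (simp add: slice_coeffs_def M_def)
  next
    show "(\<lambda>k. slice_coeffs r d a F k \<otimes> x [^] k) \<in> {..d} \<rightarrow> carrier R"
      using slice_coeffs_closed[OF a F] x by (auto simp: PiE_iff)
  qed simp
  finally show ?thesis .
qed

section \<open>Additivity of slices and polynomials with prescribed slices\<close>

lemma (in cring) slice_coeffs_add:
  assumes a: "a \<in> {1..r - 1} \<rightarrow> carrier R" and F: "F \<in> polys_deg_le R r d"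
    and G: "G \<in> polys_deg_le R r d" and k: "k \<le> d"
  shows "slice_coeffs r d a (\<lambda>m. F m \<oplus> G m) k = slice_coeffs r d a F k \<oplus> slice_coeffs r d a G k"
proof -
  let ?M = "{m \<in> monoms r d. count m r = k}"
  have c: "F m \<in> carrier R" "G m \<in> carrier R" for m
    using F G by (auto simp: polys_deg_le_iff)
  have v: "monom_value r a m \<in> carrier R" if "m \<in> ?M" for m
    using that monom_value_closed[OF a, of m d] by simp
  have "(\<Oplus>m\<in>?M. (F m \<oplus> G m) \<otimes> monom_value r a m) =
      (\<Oplus>m\<in>?M. F m \<otimes> monom_value r a m \<oplus> G m \<otimes> monom_value r a m)"
    using c v by (intro finsum_cong') (auto simp: l_distr)
  also have "\<dots> = (\<Oplus>m\<in>?M. F m \<otimes> monom_value r a m) \<oplus> (\<Oplus>m\<in>?M. G m \<otimes> monom_value r a m)"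
    using c v by (intro finsum_addf) auto
  finally show ?thesis using k by (simp add: slice_coeffs_def)
qed

text \<open>The witness is the sum over \<open>k\<close> of
  \<open>(\<alpha> k + \<beta> k X_i) X_r^k\<close>. The condition
  \<open>\<beta> d = \<zero>\<close> keeps the total degree at most \<open>d\<close>, as
  \<open>X_i X_r^d\<close> has degree \<open>d + 1\<close>.\<close>

lemma (in domain) exists_poly_affine_slices:
  assumes i: "i \<in> {1..r - 1}" and \<alpha>: "\<alpha> \<in> {..d} \<rightarrow> carrier R" and \<beta>: "\<beta> \<in> {..d} \<rightarrow> carrier R"
    and \<beta>d: "\<beta> d = \<zero>"
  obtains D where "D \<in> polys_deg_le R r d"
    "\<And>a k. a \<in> {1..r - 1} \<rightarrow> carrier R \<Longrightarrow> k \<le> d \<Longrightarrow> slice_coeffs r d a D k = \<alpha> k \<oplus> \<beta> k \<otimes> a i"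
proof
  define xpow where "xpow k = replicate_mset k r" for k
  \<comment> \<open>The index \<open>k\<close> is read off as the exponent of \<open>X_r\<close>,
    which works for both kinds of monomial since \<open>i\<close> differs from
    \<open>r\<close>.\<close>
  define D where "D m = (let k = count m r in if k \<le> d \<and> m = xpow k then \<alpha> k
      else if k \<le> d \<and> m = add_mset i (xpow k) then \<beta> k else \<zero>)" for m
  have ir: "i \<noteq> r" "1 \<le> i" "i \<le> r" "1 \<le> r" using i by auto
  have cnt [simp]: "count (xpow k) r = k" "count (add_mset i (xpow k)) r = k" for k
    using ir by (auto simp: xpow_def)
  have neq: "add_mset i (xpow k) \<noteq> xpow l" for k l
  proof
    assume "add_mset i (xpow k) = xpow l"
    then have "i \<in># xpow l" by (metis union_single_eq_member)
    then show False using ir by (simp add: xpow_def split: if_splits)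
  qed
  have Dc: "D m \<in> carrier R" for m
    using \<alpha> \<beta> by (auto simp: D_def Let_def)
  have Dm: "m \<in> monoms r d" if "D m \<noteq> \<zero>" for m
  proof (cases "m = xpow (count m r)")
    case True
    then have "count m r \<le> d" using that by (auto simp: D_def Let_def split: if_splits)
    then have "xpow (count m r) \<in> monoms r d"
      using ir by (auto simp: monoms_def xpow_def split: if_splits)
    with True show ?thesis by simp
  next
    case False
    then have *: "m = add_mset i (xpow (count m r))" "count m r \<le> d" "\<beta> (count m r) \<noteq> \<zero>"
      using that by (auto simp: D_def Let_def split: if_splits)
    with \<beta>d have "count m r < d" by (metis le_neq_implies_less)
    then have "add_mset i (xpow (count m r)) \<in> monoms r d"
      using ir by (auto simp: monoms_def xpow_def split: if_splits)
    with * show ?thesis by simp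
  qed
  show "D \<in> polys_deg_le R r d"
    using Dc Dm by (auto simp: polys_deg_le_iff)
  fix a k assume a: "a \<in> {1..r - 1} \<rightarrow> carrier R" and k: "k \<le> d"
  have ai: "a i \<in> carrier R" using a i by auto
  let ?f = "\<lambda>m. D m \<otimes> monom_value r a m"
  have vx: "monom_value r a (xpow k) = \<one>"
    unfolding monom_value_def by (rule finprod_one_eqI) (auto simp: xpow_def split: if_splits)
  have "set_mset (add_mset i (xpow k)) - {r} = {i}"
    using ir by (auto simp: xpow_def split: if_splits)
  moreover have "count (add_mset i (xpow k)) i = 1"
    using ir by (simp add: xpow_def)
  ultimately have vix: "monom_value r a (add_mset i (xpow k)) = a i"
    unfolding monom_value_def using ai by (simp add: nat_pow_def)
  have Dx: "D (xpow k) = \<alpha> k" "D (add_mset i (xpow k)) = \<beta> k"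
    using k neq ir by (auto simp: D_def Let_def)
  have "slice_coeffs r d a D k = (\<Oplus>m\<in>{m \<in> monoms r d. count m r = k}. ?f m)"
    using k by (simp add: slice_coeffs_def)
  also have "\<dots> = (\<Oplus>m\<in>{xpow k, add_mset i (xpow k)}. ?f m)"
  proof (rule add.finprod_mono_neutral_cong)
    show "?f m = \<zero>" if "m \<in> {xpow k, add_mset i (xpow k)} - {m \<in> monoms r d. count m r = k}" for m
    proof -
      have "D m = \<zero>" using that Dm[of m] ir by auto
      moreover have "monom_value r a m \<in> carrier R" using that vx vix ai by auto
      ultimately show ?thesis by simp
    qed
    show "?f m = \<zero>" if "m \<in> {m \<in> monoms r d. count m r = k} - {xpow k, add_mset i (xpow k)}" for m
      using that monom_value_closed[OF a, of m d] by (auto simp: D_def Let_def)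
    show "?f \<in> {m \<in> monoms r d. count m r = k} \<rightarrow> carrier R"
      using Dc monom_value_closed[OF a] by auto
    show "?f \<in> {xpow k, add_mset i (xpow k)} \<rightarrow> carrier R"
      using Dc vx vix ai by auto
  qed auto
  also have "\<dots> = \<alpha> k \<oplus> \<beta> k \<otimes> a i"
    using \<alpha> \<beta> k ai neq[of k k, symmetric] by (simp add: Dx vx vix Pi_iff)
  finally show "slice_coeffs r d a D k = \<alpha> k \<oplus> \<beta> k \<otimes> a i" .
qed

text \<open>Linear interpolation in a coordinate \<open>i\<close> where \<open>a\<close> and
  \<open>b\<close> differ. Equal top entries give slope zero at \<open>k = d\<close>, as the degree
  bound requires.\<close>

lemma (in field) exists_poly_two_slices:
  assumes ab: "a \<in> {1..r - 1} \<rightarrow>\<^sub>E carrier R" "b \<in> {1..r - 1} \<rightarrow>\<^sub>E carrier R" "a \<noteq> b"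
    and e: "e \<in> {..d} \<rightarrow> carrier R" and e': "e' \<in> {..d} \<rightarrow> carrier R" and top: "e d = e' d"
  obtains D where "D \<in> polys_deg_le R r d"
    "\<And>k. k \<le> d \<Longrightarrow> slice_coeffs r d a D k = e k" "\<And>k. k \<le> d \<Longrightarrow> slice_coeffs r d b D k = e' k"
proof -
  obtain i where i: "i \<in> {1..r - 1}" "a i \<noteq> b i"
    using ab PiE_ext by metis
  have c: "a i \<in> carrier R" "b i \<in> carrier R" using ab i by auto
  define t where "t = inv (a i \<ominus> b i)"
  have unit: "a i \<ominus> b i \<in> Units R" using i c by (simp add: field_Units)
  then have t: "t \<in> carrier R" "(a i \<ominus> b i) \<otimes> t = \<one>"
    by (auto simp: t_def)
  \<comment> \<open>Slope and intercept of the line through \<open>(a i, e k)\<close> and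
    \<open>(b i, e' k)\<close>.\<close>
  define \<beta> where "\<beta> k = (e k \<ominus> e' k) \<otimes> t" for k
  define \<alpha> where "\<alpha> k = e k \<ominus> \<beta> k \<otimes> a i" for k
  have \<beta>: "\<beta> \<in> {..d} \<rightarrow> carrier R" using e e' t by (auto simp: \<beta>_def Pi_iff)
  have \<alpha>: "\<alpha> \<in> {..d} \<rightarrow> carrier R" using e \<beta> c by (auto simp: \<alpha>_def Pi_iff)
  have "e' d \<in> carrier R" using e' by auto
  then have "e' d \<ominus> e' d = \<zero>" by simp
  then have "\<beta> d = \<zero>" using t top by (simp add: \<beta>_def)
  from exists_poly_affine_slices[OF i(1) \<alpha> \<beta> this] obtain D where D: "D \<in> polys_deg_le R r d"
    "\<And>a k. a \<in> {1..r - 1} \<rightarrow> carrier R \<Longrightarrow> k \<le> d \<Longrightarrow> slice_coeffs r d a D k = \<alpha> k \<oplus> \<beta> k \<otimes> a i"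
    by blast
  show ?thesis
  proof (rule that[OF D(1)])
    fix k assume k: "k \<le> d"
    have ck: "e k \<in> carrier R" "e' k \<in> carrier R" "\<beta> k \<in> carrier R" using e e' \<beta> k by auto
    have "slice_coeffs r d a D k = (e k \<ominus> \<beta> k \<otimes> a i) \<oplus> \<beta> k \<otimes> a i"
      using ab k by (simp add: D \<alpha>_def PiE_iff Pi_iff)
    also have "\<dots> = e k" using ck c by algebra
    finally show "slice_coeffs r d a D k = e k" .
    have "slice_coeffs r d b D k = (e k \<ominus> \<beta> k \<otimes> a i) \<oplus> \<beta> k \<otimes> b i"
      using ab k by (simp add: D \<alpha>_def PiE_iff Pi_iff)
    also have "\<dots> = e k \<ominus> (e k \<ominus> e' k) \<otimes> ((a i \<ominus> b i) \<otimes> t)"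
      unfolding \<beta>_def using ck c t(1) by algebra
    also have "\<dots> = e' k"
      unfolding t(2) using ck by algebra
    finally show "slice_coeffs r d b D k = e' k" .
  qed
qed

section \<open>The exact variance\<close>

text \<open>Within total degree \<open>d\<close> the only monomial with exponent \<open>d\<close> of
  \<open>X_r\<close> is \<open>X_r^d\<close> itself, which does not involve the base point.\<close>

lemma (in cring) slice_coeffs_top:
  assumes "a \<in> {1..r - 1} \<rightarrow> carrier R" "b \<in> {1..r - 1} \<rightarrow> carrier R" "F \<in> polys_deg_le R r d"
  shows "slice_coeffs r d a F d = slice_coeffs r d b F d"
proof -
  have one: "monom_value r c m = \<one>" if m: "m \<in> monoms r d" "count m r = d" for c m
  proof -
    have "m = replicate_mset d r + {#x \<in># m. x \<noteq> r#}"
      using multiset_partition[of m "\<lambda>x. x = r"] m(2)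
      by (simp add: filter_eq_replicate_mset)
    moreover have "size m \<le> d" using m by (simp add: monoms_def)
    ultimately have "{#x \<in># m. x \<noteq> r#} = {#}"
      by (metis add_le_same_cancel1 le_zero_eq size_eq_0_iff_empty size_replicate_mset size_union)
    then have "set_mset m - {r} = {}"
      by auto
    then show ?thesis unfolding monom_value_def by (simp only: finprod_empty)
  qed
  show ?thesis
    unfolding slice_coeffs_def using assms(3)
    by (auto intro!: finsum_cong' simp: one polys_deg_le_iff)
qed

section \<open>The joint distribution of two slices\<close>

definition (in ring) slice_pairs :: "nat \<Rightarrow> ((nat \<Rightarrow> 'a) \<times> (nat \<Rightarrow> 'a)) set" where
  "slice_pairs d = (\<Union>c\<in>carrier R. coeff_vectors d c \<times> coeff_vectors d c)"

lemma (in ring) mem_coeff_vectors_iff: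
  assumes "c \<in> carrier R"
  shows "u \<in> coeff_vectors d c \<longleftrightarrow> u \<in> ({..d} \<rightarrow>\<^sub>E carrier R) \<and> u d = c"
  using assms by (auto simp: coeff_vectors_def PiE_iff split: if_splits)

lemma (in ring) mem_slice_pairs_iff:
  "(u, v) \<in> slice_pairs d \<longleftrightarrow>
     u \<in> ({..d} \<rightarrow>\<^sub>E carrier R) \<and> v \<in> ({..d} \<rightarrow>\<^sub>E carrier R) \<and> u d = v d"
  by (auto simp: slice_pairs_def mem_coeff_vectors_iff PiE_iff)

lemma (in finite_field) finite_slice_pairs [simp, intro]: "finite (slice_pairs d)"
  unfolding slice_pairs_def by (intro finite_UN_I finite_SigmaI) auto

text \<open>Given the common coefficient \<open>c\<close> the two slices range independently, so
  counts multiply. The union over \<open>c\<close> is disjoint because \<open>c\<close> is the entry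
  at \<open>d\<close>.\<close>

lemma (in finite_field) card_slice_pairs_filter:
  "card {(u, v) \<in> slice_pairs d. P u \<and> Q v} =
     (\<Sum>c\<in>carrier R. card {u \<in> coeff_vectors d c. P u} * card {v \<in> coeff_vectors d c. Q v})"
proof -
  have "{(u, v) \<in> slice_pairs d. P u \<and> Q v} =
      (\<Union>c\<in>carrier R. {u \<in> coeff_vectors d c. P u} \<times> {v \<in> coeff_vectors d c. Q v})"
    by (auto simp: slice_pairs_def)
  also have "card \<dots> =
      (\<Sum>c\<in>carrier R. card ({u \<in> coeff_vectors d c. P u} \<times> {v \<in> coeff_vectors d c. Q v}))"
    by (rule card_UN_disjoint) (auto, metis coeff_vectors_closed(2))
  finally show ?thesis by (simp add: card_cartesian_product)
qed

locale two_points = finite_field R for R (structure) +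
  fixes r d :: nat and a b :: "nat \<Rightarrow> 'a"
  assumes a: "a \<in> {1..r - 1} \<rightarrow>\<^sub>E carrier R" and b: "b \<in> {1..r - 1} \<rightarrow>\<^sub>E carrier R" and neq: "a \<noteq> b"
begin

definition slices :: "(nat multiset \<Rightarrow> 'a) \<Rightarrow> (nat \<Rightarrow> 'a) \<times> (nat \<Rightarrow> 'a)" where
  "slices F = (slice_coeffs r d a F, slice_coeffs r d b F)"

lemma a_coords: "a \<in> {1..r - 1} \<rightarrow> carrier R" and b_coords: "b \<in> {1..r - 1} \<rightarrow> carrier R"
  using a b by (auto simp: PiE_iff)

lemma slices_mem: "F \<in> polys_deg_le R r d \<Longrightarrow> slices F \<in> slice_pairs d"
  unfolding slices_def mem_slice_pairs_iff
  using slice_coeffs_closed[OF a_coords] slice_coeffs_closed[OF b_coords] slice_coeffs_top[OF a_coords b_coords] by blast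

text \<open>Adding a polynomial with slices \<open>h' - h\<close> injects the fibre over \<open>h\<close> into the one over \<open>h'\<close>.\<close>

lemma card_fibre_le:
  assumes h: "h \<in> slice_pairs d" and h': "h' \<in> slice_pairs d"
  shows "card {F \<in> polys_deg_le R r d. slices F = h} \<le> card {F \<in> polys_deg_le R r d. slices F = h'}"
proof -
  obtain u v u' v' where huv: "h = (u, v)" "h' = (u', v')" by (metis surj_pair)
  have uv: "u \<in> {..d} \<rightarrow>\<^sub>E carrier R" "v \<in> {..d} \<rightarrow>\<^sub>E carrier R" "u d = v d"
    and uv': "u' \<in> {..d} \<rightarrow>\<^sub>E carrier R" "v' \<in> {..d} \<rightarrow>\<^sub>E carrier R" "u' d = v' d"
    using h h' huv mem_slice_pairs_iff by auto
  have "(\<lambda>k. u' k \<ominus> u k) \<in> {..d} \<rightarrow> carrier R" "(\<lambda>k. v' k \<ominus> v k) \<in> {..d} \<rightarrow> carrier R"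
    "u' d \<ominus> u d = v' d \<ominus> v d"
    using uv uv' by (auto simp: PiE_iff)
  from exists_poly_two_slices[OF a b neq this] obtain D where D: "D \<in> polys_deg_le R r d"
    "\<And>k. k \<le> d \<Longrightarrow> slice_coeffs r d a D k = u' k \<ominus> u k"
    "\<And>k. k \<le> d \<Longrightarrow> slice_coeffs r d b D k = v' k \<ominus> v k"
    by blast
  define \<tau> where "\<tau> F = (\<lambda>m. F m \<oplus> D m)" for F
  show ?thesis
  proof (rule card_inj_on_le[of \<tau>])
    show "inj_on \<tau> {F \<in> polys_deg_le R r d. slices F = h}"
    proof (rule inj_onI, rule ext)
      fix F G m
      assume *: "F \<in> {F \<in> polys_deg_le R r d. slices F = h}"
        "G \<in> {F \<in> polys_deg_le R r d. slices F = h}" "\<tau> F = \<tau> G"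
      then have "F m \<oplus> D m = G m \<oplus> D m" by (metis \<tau>_def)
      with * D(1) show "F m = G m" by (auto simp: polys_deg_le_iff)
    qed
    show "\<tau> ` {F \<in> polys_deg_le R r d. slices F = h} \<subseteq> {F \<in> polys_deg_le R r d. slices F = h'}"
    proof clarsimp
      fix F assume F: "F \<in> polys_deg_le R r d" and h_eq: "h = slices F"
      have \<tau>F: "\<tau> F \<in> polys_deg_le R r d"
        using F D(1) by (auto simp: \<tau>_def polys_deg_le_iff) (metis r_zero zero_closed)
      have cancel: "x \<oplus> (y \<ominus> x) = y" if "x \<in> carrier R" "y \<in> carrier R" for x y
        using that by algebra
      have "slice_coeffs r d a (\<tau> F) = u'"
      proof (rule PiE_ext[OF slice_coeffs_closed[OF a_coords \<tau>F] uv'(1)])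
        fix k assume "k \<in> {..d}"
        then show "slice_coeffs r d a (\<tau> F) k = u' k"
          using h_eq huv uv(1) uv'(1) slice_coeffs_add[OF a_coords F D(1), of k] cancel[of "u k" "u' k"]
          by (auto simp: slices_def \<tau>_def D(2))
      qed
      moreover have "slice_coeffs r d b (\<tau> F) = v'"
      proof (rule PiE_ext[OF slice_coeffs_closed[OF b_coords \<tau>F] uv'(2)])
        fix k assume "k \<in> {..d}"
        then show "slice_coeffs r d b (\<tau> F) k = v' k"
          using h_eq huv uv(2) uv'(2) slice_coeffs_add[OF b_coords F D(1), of k] cancel[of "v k" "v' k"]
          by (auto simp: slices_def \<tau>_def D(3))
      qed
      ultimately show "\<tau> F \<in> polys_deg_le R r d \<and> slices (\<tau> F) = h'"
        using \<tau>F huv by (simp add: slices_def)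
    qed
  qed simp
qed

text \<open>Injections in both directions give all fibres of \<open>slices\<close> over
  \<open>slice_pairs d\<close> the same size, so the pair of slices is uniform there. The equality
  of proportions is cross-multiplied to stay in the natural numbers.\<close>

lemma card_slices_event:
  "card {F \<in> polys_deg_le R r d. slices F \<in> {(u, v) \<in> slice_pairs d. P u \<and> Q v}} * card (slice_pairs d) =
     card (polys_deg_le R r d) * card {(u, v) \<in> slice_pairs d. P u \<and> Q v}"
proof -
  obtain h0 where h0: "h0 \<in> slice_pairs d"
    using slices_mem card_polys_deg_le_pos[OF finite_polys_deg_le, of r d]
    by (metis card.empty equals0I less_numeral_extra(3))
  define N where "N = card {F \<in> polys_deg_le R r d. slices F = h0}"
  have fibre: "card {F \<in> polys_deg_le R r d. slices F = h} = N" if "h \<in> slice_pairs d" for h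
    unfolding N_def using card_fibre_le h0 that by (intro antisym) auto
  have count: "card {F \<in> polys_deg_le R r d. slices F \<in> B} = card B * N" if B: "B \<subseteq> slice_pairs d" for B
  proof -
    have "{F \<in> polys_deg_le R r d. slices F \<in> B} = (\<Union>h\<in>B. {F \<in> polys_deg_le R r d. slices F = h})"
      by auto
    also have "card \<dots> = (\<Sum>h\<in>B. card {F \<in> polys_deg_le R r d. slices F = h})"
      using B finite_subset[OF B] by (intro card_UN_disjoint) auto
    also have "\<dots> = (\<Sum>h\<in>B. N)"
      using B fibre by (intro sum.cong) auto
    finally show ?thesis by simp
  qed
  have "{F \<in> polys_deg_le R r d. slices F \<in> slice_pairs d} = polys_deg_le R r d"
    using slices_mem by auto
  with count[of "slice_pairs d"] have "card (polys_deg_le R r d) = card (slice_pairs d) * N"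
    by simp
  moreover have "{(u, v) \<in> slice_pairs d. P u \<and> Q v} \<subseteq> slice_pairs d" by auto
  ultimately show ?thesis by (simp only: count) simp
qed

end

section \<open>Polynomials with a root above one or two base points\<close>

definition (in ring) has_root_above :: "nat \<Rightarrow> (nat multiset \<Rightarrow> 'a) \<Rightarrow> (nat \<Rightarrow> 'a) \<Rightarrow> bool" where
  "has_root_above r F a \<longleftrightarrow> (\<exists>x\<in>carrier R. eval_at R (a(r := x)) F = \<zero>)"

lemma (in cring) has_root_above_iff:
  assumes "a \<in> {1..r - 1} \<rightarrow>\<^sub>E carrier R" "F \<in> polys_deg_le R r d"
  shows "has_root_above r F a \<longleftrightarrow> roots_of d (slice_coeffs r d a F) \<noteq> {}"
proof -
  have "a \<in> {1..r - 1} \<rightarrow> carrier R" using assms by auto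
  from eval_at_slice[OF this _ assms(2)] show ?thesis
    by (auto simp: has_root_above_def roots_of_def)
qed

context finite_field
begin

lemma order_ge_2: "order R \<ge> 2"
proof -
  have "card {\<zero>, \<one>} \<le> card (carrier R)"
    by (rule card_mono) auto
  then show ?thesis by (simp add: order_def)
qed

definition rootful :: "nat \<Rightarrow> 'a \<Rightarrow> nat" where
  "rootful d c = card {u \<in> coeff_vectors d c. roots_of d u \<noteq> {}}"

lemma card_slice_pairs: "card (slice_pairs d) = order R * order R ^ d * order R ^ d"
proof -
  have "card {(u, v) \<in> slice_pairs d. True \<and> True} = order R * order R ^ d * order R ^ d"
    unfolding card_slice_pairs_filter by (simp add: card_coeff_vectors order_def)
  then show ?thesis by simp
qed

lemma card_two_roots:
  assumes "a \<in> {1..r - 1} \<rightarrow>\<^sub>E carrier R" "b \<in> {1..r - 1} \<rightarrow>\<^sub>E carrier R" "a \<noteq> b"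
  shows "card {F \<in> polys_deg_le R r d. has_root_above r F a \<and> has_root_above r F b}
           * (order R * order R ^ d * order R ^ d) =
         card (polys_deg_le R r d) * (\<Sum>c\<in>carrier R. rootful d c * rootful d c)"
proof -
  interpret two_points R r d a b using assms by unfold_locales
  have "{F \<in> polys_deg_le R r d. has_root_above r F a \<and> has_root_above r F b} =
      {F \<in> polys_deg_le R r d. slices F \<in> {(u, v) \<in> slice_pairs d. roots_of d u \<noteq> {} \<and> roots_of d v \<noteq> {}}}"
    using slices_mem by (auto simp: has_root_above_iff[OF assms(1)] has_root_above_iff[OF assms(2)] slices_def)
  then show ?thesis
    using card_slices_event[of "\<lambda>u. roots_of d u \<noteq> {}" "\<lambda>u. roots_of d u \<noteq> {}"]
    by (simp only: card_slice_pairs_filter card_slice_pairs rootful_def)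
qed

text \<open>A marginal of the two-point distribution: the second slice is left unconstrained and its
  factor \<open>order R ^ d\<close> is cancelled.\<close>

lemma card_one_root:
  assumes r: "r \<ge> 2" and a: "a \<in> {1..r - 1} \<rightarrow>\<^sub>E carrier R"
  shows "card {F \<in> polys_deg_le R r d. has_root_above r F a} * (order R * order R ^ d) =
         card (polys_deg_le R r d) * (\<Sum>c\<in>carrier R. rootful d c)"
proof -
  \<comment> \<open>Since \<open>r \<ge> 2\<close> the coordinate 1 exists, and changing it gives an
    auxiliary second point.\<close>
  define y where "y = (if a 1 = \<zero> then \<one> else \<zero>)"
  define b where "b = a(1 := y)"
  have b: "b \<in> {1..r - 1} \<rightarrow>\<^sub>E carrier R"
    using a r by (auto simp: b_def y_def PiE_iff extensional_def)
  have ab: "a \<noteq> b"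
    by (auto simp: b_def y_def fun_eq_iff)
  interpret two_points R r d a b using a b ab by unfold_locales
  have "{F \<in> polys_deg_le R r d. has_root_above r F a} =
      {F \<in> polys_deg_le R r d. slices F \<in> {(u, v) \<in> slice_pairs d. roots_of d u \<noteq> {} \<and> True}}"
    using slices_mem by (auto simp: has_root_above_iff[OF assms(2)] slices_def)
  then have "card {F \<in> polys_deg_le R r d. has_root_above r F a} * (order R * order R ^ d * order R ^ d) =
      card (polys_deg_le R r d) * (\<Sum>c\<in>carrier R. rootful d c * card {u \<in> coeff_vectors d c. True})"
    using card_slices_event[of "\<lambda>u. roots_of d u \<noteq> {}" "\<lambda>u. True"]
    by (simp only: card_slice_pairs_filter card_slice_pairs rootful_def)
  also have "\<dots> = card (polys_deg_le R r d) * (\<Sum>c\<in>carrier R. rootful d c * order R ^ d)"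
    by (simp add: card_coeff_vectors)
  finally have "order R ^ d * (card {F \<in> polys_deg_le R r d. has_root_above r F a} * (order R * order R ^ d)) =
      order R ^ d * (card (polys_deg_le R r d) * (\<Sum>c\<in>carrier R. rootful d c))"
    unfolding sum_distrib_right[symmetric] by (simp only: mult.commute mult.left_commute mult.assoc)
  then show ?thesis
    using order_ge_2 by simp
qed

end

text \<open>Expansion of the square of a sum of indicators: the \<open>N\<close> diagonal pairs
  contribute \<open>p\<close>, the \<open>N * (N - 1)\<close> others the common joint probability
  \<open>w\<close>.\<close>

lemma variance_of_counts:
  fixes p w :: real
  assumes fin: "finite \<Omega>" "finite A" and ne: "\<Omega> \<noteq> {}"
    and one: "\<And>a. a \<in> A \<Longrightarrow> real (card {F \<in> \<Omega>. Z F a}) = real (card \<Omega>) * p"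
    and two: "\<And>a b. a \<in> A \<Longrightarrow> b \<in> A \<Longrightarrow> a \<noteq> b \<Longrightarrow>
      real (card {F \<in> \<Omega>. Z F a \<and> Z F b}) = real (card \<Omega>) * w"
  defines "N \<equiv> real (card A)"
  defines "Y \<equiv> \<lambda>F. real (card {a \<in> A. Z F a})"
  shows "1 / real (card \<Omega>) * (\<Sum>F\<in>\<Omega>. Y F) = N * p"
    and "1 / real (card \<Omega>) * (\<Sum>F\<in>\<Omega>. (Y F - N * p)\<^sup>2) = N * p * (1 - p) + N * (N - 1) * (w - p\<^sup>2)"
proof -
  define n where "n = real (card \<Omega>)"
  have n: "n > 0" using fin ne by (simp add: n_def card_gt_0_iff)
  define z where "z F a = (if Z F a then 1 else 0 :: real)" for F a
  have Y: "Y F = (\<Sum>a\<in>A. z F a)" for F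
    unfolding Y_def z_def using fin by (simp add: sum.If_cases Int_def)
  have zz: "z F a * z F b = (if Z F a \<and> Z F b then 1 else 0)" for F a b
    by (simp add: z_def)
  have S1: "(\<Sum>F\<in>\<Omega>. Y F) = n * (N * p)"
  proof -
    have "(\<Sum>F\<in>\<Omega>. Y F) = (\<Sum>a\<in>A. \<Sum>F\<in>\<Omega>. z F a)"
      unfolding Y by (rule sum.swap)
    also have "\<dots> = (\<Sum>a\<in>A. n * p)"
      using fin one by (intro sum.cong) (auto simp: z_def sum.If_cases Int_def n_def)
    finally show ?thesis by (simp add: N_def)
  qed
  have S2: "(\<Sum>F\<in>\<Omega>. (Y F)\<^sup>2) = n * (N * p + N * (N - 1) * w)"
  proof -
    have "(\<Sum>F\<in>\<Omega>. (Y F)\<^sup>2) = (\<Sum>F\<in>\<Omega>. \<Sum>a\<in>A. \<Sum>b\<in>A. z F a * z F b)"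
      by (simp add: Y power2_eq_square sum_product)
    also have "\<dots> = (\<Sum>a\<in>A. \<Sum>F\<in>\<Omega>. \<Sum>b\<in>A. z F a * z F b)"
      by (rule sum.swap)
    also have "\<dots> = (\<Sum>a\<in>A. \<Sum>b\<in>A. \<Sum>F\<in>\<Omega>. z F a * z F b)"
      by (intro sum.cong refl sum.swap)
    \<comment> \<open>Every pair is charged \<open>w\<close>; the correction \<open>p - w\<close>
      repairs the diagonal, where an indicator equals its square.\<close>
    also have "\<dots> = (\<Sum>a\<in>A. \<Sum>b\<in>A. n * w + (if b = a then n * (p - w) else 0))"
    proof (intro sum.cong refl)
      fix a b assume ab: "a \<in> A" "b \<in> A"
      have "(\<Sum>F\<in>\<Omega>. z F a * z F b) = real (card {F \<in> \<Omega>. Z F a \<and> Z F b})"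
        unfolding zz using fin by (simp add: sum.If_cases Int_def)
      then show "(\<Sum>F\<in>\<Omega>. z F a * z F b) = n * w + (if b = a then n * (p - w) else 0)"
        using one[of a] two[of a b] ab by (cases "a = b") (auto simp: n_def algebra_simps)
    qed
    also have "\<dots> = (\<Sum>a\<in>A. N * (n * w) + n * (p - w))"
      using fin by (simp add: sum.distrib N_def)
    also have "\<dots> = n * (N * p + N * (N - 1) * w)"
      by (simp add: N_def algebra_simps)
    finally show ?thesis .
  qed
  show "1 / real (card \<Omega>) * (\<Sum>F\<in>\<Omega>. Y F) = N * p"
    using n by (simp add: S1 flip: n_def)
  have "(\<Sum>F\<in>\<Omega>. (Y F - N * p)\<^sup>2) = (\<Sum>F\<in>\<Omega>. (Y F)\<^sup>2) - 2 * (N * p) * (\<Sum>F\<in>\<Omega>. Y F) + n * (N * p)\<^sup>2"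
  proof -
    have "(Y F - N * p)\<^sup>2 = (Y F)\<^sup>2 - 2 * (N * p) * Y F + (N * p)\<^sup>2" for F
      by (simp add: power2_diff)
    then show ?thesis
      by (simp add: sum.distrib sum_subtractf n_def flip: sum_distrib_left)
  qed
  also have "\<dots> = n * (N * p * (1 - p) + N * (N - 1) * (w - p\<^sup>2))"
    unfolding S1 S2 by (simp add: power2_eq_square algebra_simps)
  finally show "1 / real (card \<Omega>) * (\<Sum>F\<in>\<Omega>. (Y F - N * p)\<^sup>2) = N * p * (1 - p) + N * (N - 1) * (w - p\<^sup>2)"
    using n by (simp flip: n_def)
qed

text \<open>For \<open>q\<close> the order of the field this is the proportion of root-free vectors
  in \<open>coeff_vectors d c\<close> for any nonzero \<open>c\<close>.\<close>

definition rootless_ratio :: "nat \<Rightarrow> nat \<Rightarrow> real" where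
  "rootless_ratio d q = (\<Sum>j\<le>d. (- 1) ^ j * real (q choose j) / real q ^ j)"

text \<open>The truncated alternating sum does not vanish for the zero polynomial, which has \<open>q\<close> roots;
  among the \<open>q\<^sup>d\<close> vectors with \<open>c = 0\<close> it contributes this error.\<close>

definition zero_defect :: "nat \<Rightarrow> nat \<Rightarrow> real" where
  "zero_defect d q = (\<Sum>j\<le>d. (- 1) ^ j * real (q choose j)) / real q ^ d"

text \<open>The complement of \<open>card_rootless\<close> with the power \<open>order R ^ d\<close>
  taken out; the correction for \<open>c = \<zero>\<close> thereby changes sign.\<close>

lemma (in finite_field) rootful_ratio:
  assumes c: "c \<in> carrier R"
  shows "real (rootful d c) = real (order R) ^ d *
    (1 - rootless_ratio d (order R) + (if c = \<zero> then zero_defect d (order R) else 0))"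
proof -
  define q where "q = real (order R)"
  have q: "q > 0" using order_ge_2 by (simp add: q_def)
  let ?W = "coeff_vectors d c"
  have "card ({u \<in> ?W. roots_of d u \<noteq> {}} \<union> {u \<in> ?W. roots_of d u = {}}) =
      rootful d c + card {u \<in> ?W. roots_of d u = {}}"
    unfolding rootful_def by (rule card_Un_disjoint) auto
  moreover have "{u \<in> ?W. roots_of d u \<noteq> {}} \<union> {u \<in> ?W. roots_of d u = {}} = ?W"
    by auto
  ultimately have "order R ^ d = rootful d c + card {u \<in> ?W. roots_of d u = {}}"
    by (simp only: card_coeff_vectors)
  then have "real (rootful d c) = q ^ d - real (card {u \<in> ?W. roots_of d u = {}})"
    by (simp add: q_def flip: of_nat_power)
  moreover have "(\<Sum>j\<le>d. (- 1) ^ j * real (order R choose j) * q ^ (d - j)) =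
      q ^ d * rootless_ratio d (order R)"
    unfolding rootless_ratio_def sum_distrib_left
    using q by (intro sum.cong) (auto simp: q_def[symmetric] power_diff)
  moreover have "(\<Sum>j\<le>d. (- 1) ^ j * real (order R choose j)) = q ^ d * zero_defect d (order R)"
    using q by (simp add: zero_defect_def flip: q_def)
  ultimately show ?thesis
    using card_rootless[OF c, of d] by (simp add: q_def[symmetric] algebra_simps)
qed

text \<open>The covariance \<open>w - p\<^sup>2\<close> of two distinct base points is the variance,
  over uniform \<open>c\<close>, of the ratio that is \<open>s + \<kappa>\<close> at
  \<open>c = \<zero>\<close> and \<open>s\<close> elsewhere. This is \<open>\<kappa>\<^sup>2\<close>
  times the variance of an indicator of probability \<open>1 / q\<close>.\<close>

lemma (in finite_field) NS_variance_exact: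
  fixes d r :: nat
  assumes r: "r \<ge> 2"
  defines "q \<equiv> real (order R)"
  defines "\<kappa> \<equiv> zero_defect d (order R)"
  defines "p \<equiv> 1 - rootless_ratio d (order R) + \<kappa> / q"
  shows "NS_variance R r d =
    q ^ (r - 1) * p * (1 - p) + q ^ (r - 1) * (q ^ (r - 1) - 1) * (\<kappa>\<^sup>2 * (q - 1) / q\<^sup>2)"
proof -
  define s where "s = 1 - rootless_ratio d (order R)"
  define w where "w = s\<^sup>2 + (2 * s * \<kappa> + \<kappa>\<^sup>2) / q"
  have q: "q > 0" using order_ge_2 by (simp add: q_def)
  have p: "p = s + \<kappa> / q" by (simp add: p_def s_def)
  let ?P = "polys_deg_le R r d"
  let ?A = "{1..r - 1} \<rightarrow>\<^sub>E carrier R"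
  have rf: "real (rootful d c) = q ^ d * (s + (if c = \<zero> then \<kappa> else 0))" if "c \<in> carrier R" for c
    using rootful_ratio[OF that] by (simp add: q_def s_def \<kappa>_def)
  have sum1: "(\<Sum>c\<in>carrier R. real (rootful d c)) = q * q ^ d * p"
  proof -
    have "(\<Sum>c\<in>carrier R. real (rootful d c)) = q ^ d * (\<Sum>c\<in>carrier R. s + (if c = \<zero> then \<kappa> else 0))"
      by (simp add: rf sum_distrib_left)
    also have "(\<Sum>c\<in>carrier R. s + (if c = \<zero> then \<kappa> else 0)) = q * s + \<kappa>"
      by (simp add: sum.distrib q_def order_def)
    finally show ?thesis using q by (simp add: p field_simps)
  qed
  have sum2: "(\<Sum>c\<in>carrier R. real (rootful d c) * real (rootful d c)) = q * q ^ d * q ^ d * w"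
  proof -
    have "(\<Sum>c\<in>carrier R. real (rootful d c) * real (rootful d c)) =
        (\<Sum>c\<in>carrier R. q ^ d * q ^ d * (s\<^sup>2 + (if c = \<zero> then 2 * s * \<kappa> + \<kappa>\<^sup>2 else 0)))"
      by (intro sum.cong) (auto simp: rf power2_eq_square algebra_simps)
    also have "\<dots> = q ^ d * q ^ d * (\<Sum>c\<in>carrier R. s\<^sup>2 + (if c = \<zero> then 2 * s * \<kappa> + \<kappa>\<^sup>2 else 0))"
      by (simp only: sum_distrib_left)
    also have "(\<Sum>c\<in>carrier R. s\<^sup>2 + (if c = \<zero> then 2 * s * \<kappa> + \<kappa>\<^sup>2 else 0)) = q * s\<^sup>2 + (2 * s * \<kappa> + \<kappa>\<^sup>2)"
      by (simp add: sum.distrib q_def order_def)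
    finally show ?thesis using q by (simp add: w_def field_simps)
  qed
  have one: "real (card {F \<in> ?P. has_root_above r F a}) = real (card ?P) * p" if a: "a \<in> ?A" for a
  proof -
    have "real (card {F \<in> ?P. has_root_above r F a}) * (q * q ^ d) = real (card ?P) * (q * q ^ d * p)"
      using arg_cong[OF card_one_root[OF r a, of d], of real] by (simp add: q_def[symmetric] sum1)
    then show ?thesis using q by simp
  qed
  have two: "real (card {F \<in> ?P. has_root_above r F a \<and> has_root_above r F b}) = real (card ?P) * w"
    if ab: "a \<in> ?A" "b \<in> ?A" "a \<noteq> b" for a b
  proof -
    have "real (card {F \<in> ?P. has_root_above r F a \<and> has_root_above r F b}) * (q * q ^ d * q ^ d) =
        real (card ?P) * (q * q ^ d * q ^ d * w)"
      using arg_cong[OF card_two_roots[OF ab, of d], of real] by (simp add: q_def[symmetric] sum2)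
    then show ?thesis using q by simp
  qed
  have ne: "?P \<noteq> {}" using card_polys_deg_le_pos[OF finite_polys_deg_le, of r d] by auto
  have finA: "finite ?A" by (intro finite_PiE) auto
  have N: "real (card ?A) = q ^ (r - 1)"
    by (simp add: card_PiE q_def order_def)
  have NS: "NS R r F = card {a \<in> ?A. has_root_above r F a}" for F
    by (simp add: NS_def has_root_above_def)
  note var = variance_of_counts[of ?P ?A "\<lambda>F a. has_root_above r F a" p w,
      OF finite_polys_deg_le finA ne one two, unfolded N, folded NS]
  have mean: "NS_mean R r d = q ^ (r - 1) * p"
    unfolding NS_mean_def using var(1) by simp
  have "w - p\<^sup>2 = \<kappa>\<^sup>2 * (q - 1) / q\<^sup>2"
    using q by (simp add: w_def p field_simps power2_eq_square)
  then show ?thesis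
    unfolding NS_variance_def mean using var(2) by simp
qed

section \<open>Asymptotics\<close>

text \<open>Convergence at rate \<open>1 / q\<close>. A bare limit would leave only a little-o
  error, while this property survives arithmetic operations and yields the required error
  term.\<close>

definition fast_lim :: "(nat \<Rightarrow> real) \<Rightarrow> real \<Rightarrow> bool" where
  "fast_lim f c \<longleftrightarrow> (\<lambda>q. f q - c) \<in> O(\<lambda>q. 1 / real q)"

lemma fast_lim_const: "fast_lim (\<lambda>_. c) c"
  by (simp add: fast_lim_def)

lemma fast_lim_inverse: "fast_lim (\<lambda>q. 1 / real q) 0"
  by (simp add: fast_lim_def)

lemma fast_lim_add:
  assumes "fast_lim f a" "fast_lim g b"
  shows "fast_lim (\<lambda>q. f q + g q) (a + b)"
proof -
  have "(\<lambda>q. (f q - a) + (g q - b)) \<in> O(\<lambda>q. 1 / real q)"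
    using assms unfolding fast_lim_def by (rule sum_in_bigo)
  then show ?thesis by (simp add: fast_lim_def algebra_simps)
qed

text \<open>Based on \<open>f g - a b = (f - a) (g - b) + a (g - b) + b (f - a)\<close>; boundedness
  of \<open>1 / q\<close> controls the first summand.\<close>

lemma fast_lim_mult:
  assumes "fast_lim f a" "fast_lim g b"
  shows "fast_lim (\<lambda>q. f q * g q) (a * b)"
proof -
  have f: "(\<lambda>q. f q - a) \<in> O(\<lambda>q. 1 / real q)" and g: "(\<lambda>q. g q - b) \<in> O(\<lambda>q. 1 / real q)"
    using assms by (auto simp: fast_lim_def)
  have "(\<lambda>q. 1 / real q) \<in> O(\<lambda>_. 1)"
    by (intro bigoI[where c = 1] always_eventually) (auto simp: divide_simps)
  from landau_o.big_trans[OF g this]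
  have "(\<lambda>q. (f q - a) * (g q - b)) \<in> O(\<lambda>q. 1 / real q)"
    using landau_o.big.mult[OF f, of "\<lambda>q. g q - b" "\<lambda>_. 1"] by simp
  moreover have "(\<lambda>q. a * (g q - b)) \<in> O(\<lambda>q. 1 / real q)" "(\<lambda>q. b * (f q - a)) \<in> O(\<lambda>q. 1 / real q)"
    using f g by simp_all
  ultimately have "(\<lambda>q. (f q - a) * (g q - b) + a * (g q - b) + b * (f q - a)) \<in> O(\<lambda>q. 1 / real q)"
    by (intro sum_in_bigo)
  then show ?thesis by (simp add: fast_lim_def algebra_simps)
qed

lemma fast_lim_minus: "fast_lim f a \<Longrightarrow> fast_lim g b \<Longrightarrow> fast_lim (\<lambda>q. f q - g q) (a - b)"
  using fast_lim_add[of f a "\<lambda>q. - 1 * g q" "- 1 * b"] fast_lim_mult[OF fast_lim_const, of g b "- 1"]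
  by simp

lemma fast_lim_power: "fast_lim f a \<Longrightarrow> fast_lim (\<lambda>q. f q ^ n) (a ^ n)"
  by (induction n) (auto simp: fast_lim_const fast_lim_mult)

lemma fast_lim_sum:
  "finite A \<Longrightarrow> (\<And>j. j \<in> A \<Longrightarrow> fast_lim (f j) (c j)) \<Longrightarrow>
     fast_lim (\<lambda>q. \<Sum>j\<in>A. f j q) (\<Sum>j\<in>A. c j)"
  by (induction A rule: finite_induct) (auto simp: fast_lim_const fast_lim_add)

text \<open>Only large \<open>q\<close> count, so identities that cancel powers of \<open>q\<close>
  may fail at \<open>q = 0\<close>, where division has a default value.\<close>

lemma fast_lim_cong:
  assumes "\<And>q. q > 0 \<Longrightarrow> f q = g q"
  shows "fast_lim f c \<longleftrightarrow> fast_lim g c"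
  unfolding fast_lim_def
  by (intro landau_o.big.in_cong eventually_mono[OF eventually_gt_at_top[of 0]]) (simp add: assms)

text \<open>Induction through the ratio of consecutive terms, \<open>(1 - j / q) / (j + 1)\<close>,
  whose limit \<open>1 / (j + 1)\<close> builds up the factorial.\<close>

lemma fast_lim_binomial: "fast_lim (\<lambda>q. real (q choose j) / real q ^ j) (1 / fact j)"
proof (induction j)
  case 0
  then show ?case by (simp add: fast_lim_const)
next
  case (Suc j)
  have "fast_lim (\<lambda>q. real (q choose j) / real q ^ j * (1 - real j * (1 / real q)) * (1 / real (Suc j)))
      (1 / fact j * (1 - real j * 0) * (1 / real (Suc j)))"
    by (intro fast_lim_mult fast_lim_minus fast_lim_const fast_lim_inverse Suc.IH)
  moreover have "real (q choose j) / real q ^ j * (1 - real j * (1 / real q)) * (1 / real (Suc j)) =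
      real (q choose Suc j) / real q ^ Suc j" if "q > 0" for q
  proof -
    have "real q * real (q choose j) = real j * real (q choose j) + real (Suc j) * real (q choose Suc j)"
      using gbinomial_mult_1[of "real q" j] by (simp only: binomial_gbinomial)
    then show ?thesis
      using that by (simp add: field_simps del: of_nat_Suc binomial_Suc_Suc)
  qed
  ultimately show ?case
    by (subst fast_lim_cong[where g = "\<lambda>q. real (q choose j) / real q ^ j *
          (1 - real j * (1 / real q)) * (1 / real (Suc j))"]) (simp_all add: field_simps)
qed

section \<open>Limits of \<open>rootless_ratio\<close> and \<open>zero_defect\<close>\<close>

lemma alternating_fact_sum: "(\<Sum>j\<le>d. (- 1) ^ j * (1 / fact j)) = 1 - mu d"
proof -
  have "(\<Sum>j\<le>d. (- 1) ^ j * (1 / fact j)) = 1 + (\<Sum>j = 1..d. (- 1) ^ j * (1 / fact j :: real))"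
    by (simp add: atMost_atLeast0 sum.atLeast_Suc_atMost)
  also have "(\<Sum>j = 1..d. (- 1) ^ j * (1 / fact j :: real)) = - mu d"
    unfolding mu_def sum_negf[symmetric]
    by (intro sum.cong) (auto simp: power_eq_if)
  finally show ?thesis by simp
qed

lemma fast_lim_rootless_ratio: "fast_lim (rootless_ratio d) (1 - mu d)"
proof -
  have "fast_lim (\<lambda>q. \<Sum>j\<le>d. (- 1) ^ j * (real (q choose j) / real q ^ j)) (\<Sum>j\<le>d. (- 1) ^ j * (1 / fact j))"
    by (intro fast_lim_sum fast_lim_mult fast_lim_const fast_lim_binomial) auto
  then show ?thesis
    unfolding alternating_fact_sum by (simp add: rootless_ratio_def[abs_def])
qed

text \<open>Of the divisor \<open>q^d\<close> the term of index \<open>j\<close> uses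
  \<open>q^j\<close> for its own limit; the remaining \<open>q^(d - j)\<close> kills every term but
  \<open>j = d\<close>.\<close>

lemma fast_lim_zero_defect: "fast_lim (zero_defect d) ((- 1) ^ d / fact d)"
proof -
  have "fast_lim (\<lambda>q. \<Sum>j\<le>d. (- 1) ^ j * (real (q choose j) / real q ^ j) * (1 / real q) ^ (d - j))
      (\<Sum>j\<le>d. (- 1) ^ j * (1 / fact j) * 0 ^ (d - j))"
    by (intro fast_lim_sum fast_lim_mult fast_lim_const fast_lim_binomial fast_lim_power fast_lim_inverse) auto
  \<comment> \<open>The convention \<open>0 ^ 0 = 1\<close> singles out the top term.\<close>
  also have "(\<Sum>j\<le>d. (- 1) ^ j * (1 / fact j) * 0 ^ (d - j)) =
      (\<Sum>j\<le>d. if j = d then (- 1) ^ d / fact d else 0 :: real)"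
    by (intro sum.cong) auto
  also have "\<dots> = (- 1) ^ d / fact d"
    by simp
  finally show ?thesis
  proof (subst fast_lim_cong)
    fix q :: nat assume q: "q > 0"
    show "zero_defect d q =
        (\<Sum>j\<le>d. (- 1) ^ j * (real (q choose j) / real q ^ j) * (1 / real q) ^ (d - j))"
      unfolding zero_defect_def sum_divide_distrib
      using q by (intro sum.cong) (auto simp: power_diff field_simps)
  qed
qed

text \<open>Carries estimates in the numerical variable \<open>q\<close> over to all finite fields
  at once, with constants independent of the field.\<close>

lemma filterlim_order: "filterlim order at_top finite_fields_at_top"
  unfolding finite_fields_at_top_def
  by (rule filterlim_mono[OF filterlim_filtercomap]) auto

theorem proposition5p2:
  fixes r d :: nat
  assumes "r \<ge> 2" and "d \<ge> 2"
  shows "(\<lambda>R :: 'a ring. NS_variance R r d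
            - (1 / (fact d)\<^sup>2 * real (order R) ^ (2 * r - 3)
               + mu d * (1 - mu d) * real (order R) ^ (r - 1)))
         \<in> O[finite_fields_at_top](\<lambda>R. real (order R) ^ (2 * r - 4))"
proof -
  \<comment> \<open>Writing \<open>r = k + 2\<close> resolves the truncated subtractions in
    \<open>r - 1\<close>, \<open>2 * r - 3\<close> and \<open>2 * r - 4\<close>.\<close>
  obtain k where r: "r = k + 2" using assms(1) by (metis add.commute le_Suc_ex)
  define p where "p q = 1 - rootless_ratio d q + zero_defect d q * (1 / real q)" for q
  \<comment> \<open>The off-diagonal part of the exact variance is \<open>q^(2 r - 3)\<close> times
    \<open>g\<close>.\<close>
  define g where "g q = (1 - (1 / real q) ^ (r - 1)) * (zero_defect d q)\<^sup>2 * (1 - 1 / real q)" for q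
  define h where "h q = real q ^ (r - 1) * (p q * (1 - p q) - mu d * (1 - mu d))
      + real q ^ (2 * r - 3) * (g q - 1 / (fact d)\<^sup>2)" for q
  have "fast_lim p (1 - (1 - mu d) + (- 1) ^ d / fact d * 0)"
    unfolding p_def[abs_def]
    by (intro fast_lim_add fast_lim_minus fast_lim_mult fast_lim_const fast_lim_inverse
        fast_lim_rootless_ratio fast_lim_zero_defect)
  then have p: "fast_lim p (mu d)" by simp
  have p1: "fast_lim (\<lambda>q. p q * (1 - p q)) (mu d * (1 - mu d))"
    by (intro fast_lim_mult fast_lim_minus fast_lim_const p)
  have "fast_lim g ((1 - 0 ^ (r - 1)) * ((- 1) ^ d / fact d)\<^sup>2 * (1 - 0))"
    unfolding g_def[abs_def]
    by (intro fast_lim_mult fast_lim_minus fast_lim_const fast_lim_inverse fast_lim_power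
        fast_lim_zero_defect)
  \<comment> \<open>As \<open>r \<ge> 2\<close> the power of 0 vanishes, and the sign
    \<open>(- 1) ^ d\<close> disappears in the square.\<close>
  then have g: "fast_lim g (1 / (fact d)\<^sup>2)"
    by (simp add: r power_divide flip: power_mult)
  have "(\<lambda>q. real q ^ (r - 1) * (p q * (1 - p q) - mu d * (1 - mu d))) \<in> O(\<lambda>q. real q ^ (r - 1) * (1 / real q))"
    using p1 unfolding fast_lim_def by (rule landau_o.big.mult_left)
  \<comment> \<open>The diagonal error has order \<open>q^(r - 2)\<close>, and
    \<open>r - 2 = k\<close> is at most \<open>2 k = 2 r - 4\<close>.\<close>
  also have "(\<lambda>q. real q ^ (r - 1) * (1 / real q)) \<in> O(\<lambda>q. real q ^ (2 * r - 4))"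
  proof (intro bigoI[where c = 1] eventually_mono[OF eventually_gt_at_top[of "0 :: nat"]])
    fix q :: nat assume q: "q > 0"
    have "real q ^ k \<le> real q ^ (2 * k)"
      using q by (intro power_increasing) auto
    with q show "norm (real q ^ (r - 1) * (1 / real q)) \<le> 1 * norm (real q ^ (2 * r - 4))"
      by (simp add: r)
  qed
  finally have 1: "(\<lambda>q. real q ^ (r - 1) * (p q * (1 - p q) - mu d * (1 - mu d))) \<in> O(\<lambda>q. real q ^ (2 * r - 4))" .
  have "(\<lambda>q. real q ^ (2 * r - 3) * (g q - 1 / (fact d)\<^sup>2)) \<in> O(\<lambda>q. real q ^ (2 * r - 3) * (1 / real q))"
    using g unfolding fast_lim_def by (rule landau_o.big.mult_left)
  also have "(\<lambda>q. real q ^ (2 * r - 3) * (1 / real q)) \<in> O(\<lambda>q. real q ^ (2 * r - 4))"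
    by (intro bigoI[where c = 1] eventually_mono[OF eventually_gt_at_top[of "0 :: nat"]]) (simp add: r)
  finally have 2: "(\<lambda>q. real q ^ (2 * r - 3) * (g q - 1 / (fact d)\<^sup>2)) \<in> O(\<lambda>q. real q ^ (2 * r - 4))" .
  have "h \<in> O(\<lambda>q. real q ^ (2 * r - 4))"
    unfolding h_def[abs_def] by (rule sum_in_bigo[OF 1 2])
  from landau_o.big.compose[OF this filterlim_order]
  have "(\<lambda>R :: 'a ring. h (order R)) \<in> O[finite_fields_at_top](\<lambda>R. real (order R) ^ (2 * r - 4))" .
  moreover have "\<forall>\<^sub>F R :: 'a ring in finite_fields_at_top. NS_variance R r d
            - (1 / (fact d)\<^sup>2 * real (order R) ^ (2 * r - 3)
               + mu d * (1 - mu d) * real (order R) ^ (r - 1)) = h (order R)"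
    unfolding eventually_finite_fields_at_top
  \<comment> \<open>The identity with \<open>h\<close> holds for every finite field, so the
    threshold can be 0.\<close>
  proof (intro exI[of _ 0] allI impI)
    fix R :: "'a ring"
    assume R: "field R \<and> finite (carrier R) \<and> 0 \<le> order R"
    then interpret field R by simp
    interpret finite_field R using R by unfold_locales simp
    define q where "q = real (order R)"
    have q: "q > 0" using order_ge_2 by (simp add: q_def)
    have "NS_variance R r d = q ^ (k + 1) * p (order R) * (1 - p (order R))
        + q ^ (k + 1) * (q ^ (k + 1) - 1) * ((zero_defect d (order R))\<^sup>2 * (q - 1) / q\<^sup>2)"
      using NS_variance_exact[OF assms(1), of d] by (simp add: p_def q_def r)
    also have "q ^ (k + 1) * (q ^ (k + 1) - 1) * ((zero_defect d (order R))\<^sup>2 * (q - 1) / q\<^sup>2) =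
        q ^ (2 * k + 1) * g (order R)"
    proof -
      \<comment> \<open>Abstracting \<open>q ^ k\<close> to \<open>Q\<close> leaves a rational
        identity in two positive reals and \<open>\<kappa>\<close>.\<close>
      have "q * Q * (q * Q - 1) * (\<kappa>\<^sup>2 * (q - 1) / q\<^sup>2) =
          q * (Q * Q) * ((1 - 1 / (q * Q)) * \<kappa>\<^sup>2 * (1 - 1 / q))" if "Q > 0" for Q \<kappa>
        using q that by (simp add: field_simps power2_eq_square)
      from this[of "q ^ k"] show ?thesis
        using q by (simp add: g_def r q_def[symmetric] power_add power_one_over mult_2)
    qed
    finally show "NS_variance R r d
            - (1 / (fact d)\<^sup>2 * real (order R) ^ (2 * r - 3)
               + mu d * (1 - mu d) * real (order R) ^ (r - 1)) = h (order R)"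
      by (simp add: h_def r q_def[symmetric] algebra_simps)
  qed
  ultimately show ?thesis
    by (subst landau_o.big.in_cong)
qed

end
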